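(* Suppose that the following conditions hold. (C1) $W(0)=0$, $W(t)$ is decreasing on $(-\infty,0)$ and increasing on $(0,\infty)$. (C2) $W'(t)$ is non-decreasing, almost everywhere. (A2) For any fixed $\lambda\ge 0$ and $t$, the equation $\int_{-\infty}^{\infty}W'(s-c)\,f(s\mid t-\lambda)\,ds=0$ has the unique solution $c\equiv\psi_\lambda(t)$, such that $f(\psi_\lambda(t)\mid t-\lambda)>0$. Let $\delta_\psi(\mathbf{X})=X_2-\psi(D)$ be a location equivariant estimator of $\theta_2$, where $\psi:\mathbb{R}\to\mathbb{R}$. Let $\underline{\psi}(t)$ and $\overline{\psi}(t)$ be functions such that $\underline{\psi}(t)<\psi_\lambda(t)<\overline{\psi}(t)$ for all $\lambda\ge 0$ and $t$. For any fixed $t$, let $$\psi^*(t)=(\underline{\psi}(t)\vee\psi(t))\wedge\overline{\psi}(t)=\underline{\psi}(t)\vee(\psi(t)\wedge\overline{\psi}(t)).$$ Then $$R_2(\boldsymbol{\theta},\delta_\psi)\ \ge\ R_2(\boldsymbol{\theta},\delta_{\psi^*})\qquad\text{for any }\boldsymbol{\theta}\in\Theta_0,$$ where $\delta_{\psi^*}(\mathbf{X})=X_2-\psi^*(D)$.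
   Context: Model: $\mathbf{X}=(X_1,X_2)$ has joint probability density function $f(x_1-\theta_1,x_2-\theta_2)$, $(x_1,x_2)\in\mathbb{R}^2$, where $f$ is a specified probability density on $\mathbb{R}^2$ and $\boldsymbol{\theta}=(\theta_1,\theta_2)\in\Theta_0=\{(t_1,t_2)\in\mathbb{R}^2: t_1\le t_2\}$ is unknown. Put $D=X_2-X_1$ and $\lambda=\theta_2-\theta_1\in[0,\infty)$. The loss in estimating $\theta_2$ by $a\in\mathbb{R}$ is $W(a-\theta_2)$, where $W:\mathbb{R}\to[0,\infty)$ is a specified function, and the risk of an estimator $\delta$ is $R_2(\boldsymbol{\theta},\delta)=E_{\boldsymbol{\theta}}[W(\delta(\mathbf{X})-\theta_2)]$. A location equivariant estimator of $\theta_2$ is one of the form $\delta_\psi(\mathbf{X})=X_2-\psi(D)$ with $\psi:\mathbb{R}\to\mathbb{R}$. $x\vee y$ and $x\wedge y$ denote the maximum and the minimum of $x$ and $y$. Conditional density: $f(s\mid t)=\dfrac{f(s-t,s)}{\int_{-\infty}^{\infty}f(u-t,u)\,du}$ (the conditional density of $X_2-\theta_2$ given $D=t$ is $f(s\mid t-\lambda)$).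
   Formalization: In (C2), W is additionally assumed locally absolutely continuous (automatic for convex W); without this, losses with jumps such as t²+K·1{|t|≥1} satisfy (C1), (C2), (A2) for a skewed f and violate the conclusion. ψ is taken Borel measurable. *)

theory Defs
  imports "HOL-Analysis.Analysis"
begin

definition prob_density :: "(real \<times> real \<Rightarrow> real) \<Rightarrow> bool" where
  "prob_density f \<longleftrightarrow>
     f \<in> borel_measurable borel \<and> (\<forall>x. 0 \<le> f x) \<and> (\<integral>\<^sup>+ x. ennreal (f x) \<partial>lborel) = 1"

text \<open>The model: the law of \<open>X = (X\<^sub>1, X\<^sub>2)\<close> under \<open>\<theta> = (\<theta>\<^sub>1, \<theta>\<^sub>2)\<close>, as a measure on the plane,
  so that the coordinate projections play the role of \<open>X\<^sub>1\<close> and \<open>X\<^sub>2\<close>.\<close>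

definition location_model :: "(real \<times> real \<Rightarrow> real) \<Rightarrow> real \<times> real \<Rightarrow> (real \<times> real) measure" where
  "location_model f \<theta> = density lborel (\<lambda>(x1, x2). ennreal (f (x1 - fst \<theta>, x2 - snd \<theta>)))"

definition Theta0 :: "(real \<times> real) set" where
  "Theta0 = {(t1, t2). t1 \<le> t2}"

text \<open>The risk of an estimator of \<open>\<theta>\<^sub>2\<close>; it may be infinite. For nonmeasurable integrands
  the integral is the lower integral.\<close>

definition risk2 ::
    "(real \<times> real \<Rightarrow> real) \<Rightarrow> (real \<Rightarrow> real) \<Rightarrow> real \<times> real \<Rightarrow> (real \<times> real \<Rightarrow> real) \<Rightarrow> ennreal" where
  "risk2 f W \<theta> \<delta> = (\<integral>\<^sup>+ x. ennreal (W (\<delta> x - snd \<theta>)) \<partial>(location_model f \<theta>))"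

definition equivariant_est :: "(real \<Rightarrow> real) \<Rightarrow> real \<times> real \<Rightarrow> real" where
  "equivariant_est \<psi> = (\<lambda>(x1, x2). x2 - \<psi> (x2 - x1))"

text \<open>\<open>cond_density f t s\<close> is \<open>f(s | t)\<close>. Where the denominator vanishes or is infinite
  the value is 0 by the conventions on division and on Bochner integrals.\<close>

definition cond_density :: "(real \<times> real \<Rightarrow> real) \<Rightarrow> real \<Rightarrow> real \<Rightarrow> real" where
  "cond_density f t s = f (s - t, s) / (\<integral>u. f (u - t, u) \<partial>lborel)"

text \<open>Absolute continuity on \<open>[a, b]\<close>; a pair \<open>(u, v)\<close> in \<open>I\<close> stands for the interval \<open>[u, v]\<close>.\<close>

definition abs_continuous_on_interval :: "real \<Rightarrow> real \<Rightarrow> (real \<Rightarrow> real) \<Rightarrow> bool" where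
  "abs_continuous_on_interval a b g \<longleftrightarrow>
     (\<forall>\<epsilon>>0. \<exists>\<delta>>0. \<forall>I :: (real \<times> real) set.
        finite I \<and> (\<forall>(u, v)\<in>I. a \<le> u \<and> u \<le> v \<and> v \<le> b) \<and>
        disjoint_family_on (\<lambda>(u, v). {u<..<v}) I \<and> (\<Sum>(u, v)\<in>I. v - u) < \<delta>
        \<longrightarrow> (\<Sum>(u, v)\<in>I. \<bar>g v - g u\<bar>) < \<epsilon>)"

text \<open>The derivative is nondecreasing almost everywhere: off a null set it exists and is
  nondecreasing. Absolute continuity makes the function an integral of this derivative; without it
  the almost everywhere derivative would not see jumps or singular parts.\<close>

definition deriv_nondecreasing_ae :: "(real \<Rightarrow> real) \<Rightarrow> bool" where
  "deriv_nondecreasing_ae W \<longleftrightarrow>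
     (\<forall>a b. abs_continuous_on_interval a b W) \<and>
     (\<exists>N\<in>null_sets lborel.
        (\<forall>t\<in>- N. W differentiable (at t)) \<and> mono_on (- N) (deriv W))"

text \<open>\<open>c\<close> solves \<open>\<integral> W'(s - c) f(s | u) ds = 0\<close>, with the integral required to exist. The value
  of \<open>deriv W\<close> where \<open>W\<close> is not differentiable does not matter, since this is a null set.\<close>

definition solves_equation ::
    "(real \<times> real \<Rightarrow> real) \<Rightarrow> (real \<Rightarrow> real) \<Rightarrow> real \<Rightarrow> real \<Rightarrow> bool" where
  "solves_equation f W u c \<longleftrightarrow>
     has_bochner_integral lborel (\<lambda>s. deriv W (s - c) * cond_density f u s) 0"

end

theory Submission
  imports Defs
begin

text \<open>For fixed \<open>D = t\<close>, the function \<open>c \<mapsto> \<integral> W(s - c) f(s | t - \<lambda>) ds\<close> is convex with stationary point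
  \<open>\<psi>\<^sub>\<lambda>(t)\<close>, and \<open>\<psi>*(t)\<close> lies between \<open>\<psi>(t)\<close> and \<open>\<psi>\<^sub>\<lambda>(t)\<close>, so the conditional risk at \<open>\<psi>*(t)\<close> is not
  larger than at \<open>\<psi>(t)\<close>; integrating over \<open>t\<close> gives the claim. Concretely, for \<open>b\<close> between \<open>a\<close> and
  \<open>c = \<psi>\<^sub>\<lambda>(t)\<close> one has \<open>W(s - a) \<ge> W(s - b) + (b - a) W'(s - b) \<ge> W(s - b) + (b - a) W'(s - c)\<close> for
  almost every \<open>s\<close>, and the last term integrates to \<open>0\<close>. Since \<open>\<psi>*\<close> need not be measurable, its
  risk is a lower integral.\<close>

section \<open>Absolutely continuous functions and bounds on their increments\<close>

lemma abs_continuous_on_interval_uminus: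
  assumes "abs_continuous_on_interval a b g"
  shows "abs_continuous_on_interval a b (\<lambda>x. - g x)"
  using assms by (simp add: abs_continuous_on_interval_def abs_minus_commute)

text \<open>The single interval between \<open>x\<close> and \<open>y\<close> is an admissible
  family in the definition. Continuity later yields Borel measurability of \<open>W\<close>.\<close>

lemma abs_continuous_imp_continuous_on:
  assumes "\<And>a b. abs_continuous_on_interval a b g"
  shows "continuous_on UNIV g"
  unfolding continuous_on_iff
proof (intro ballI allI impI)
  fix x e :: real
  assume "e > 0"
  with assms[of "x - 1" "x + 1"] obtain d where "d > 0" and
    d: "\<And>I. finite I \<Longrightarrow> \<forall>(u, v)\<in>I. x - 1 \<le> u \<and> u \<le> v \<and> v \<le> x + 1 \<Longrightarrow>
        disjoint_family_on (\<lambda>(u, v). {u<..<v}) I \<Longrightarrow> (\<Sum>(u, v)\<in>I. v - u) < d \<Longrightarrow>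
        (\<Sum>(u, v)\<in>I. \<bar>g v - g u\<bar>) < e"
    unfolding abs_continuous_on_interval_def by meson
  have "dist (g y) (g x) < e" if "dist y x < min d 1" for y
    using d[of "{(min x y, max x y)}"] that
    by (cases "x \<le> y") (auto simp: disjoint_family_on_def dist_real_def abs_minus_commute)
  then show "\<exists>d>0. \<forall>y\<in>UNIV. dist y x < d \<longrightarrow> dist (g y) (g x) < e"
    using \<open>d > 0\<close> by (intro exI[of _ "min d 1"]) auto
qed

text \<open>Straddle lemma: since \<open>x\<close> lies between \<open>u\<close> and
  \<open>v\<close>, the first-order errors at the two ends are at most \<open>e * (x - u)\<close>
  and \<open>e * (v - x)\<close>, which add up to \<open>e * (v - u)\<close>.\<close>

lemma has_real_derivative_increment_le:
  assumes "(g has_real_derivative D) (at x)" "D \<le> m" "e > 0"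
  obtains r where "r > 0"
    "\<And>u v. u \<le> x \<Longrightarrow> x \<le> v \<Longrightarrow> {u..v} \<subseteq> ball x r \<Longrightarrow> g v - g u \<le> (m + e) * (v - u)"
proof -
  obtain r where "r > 0" and
    r: "\<And>y. norm (y - x) < r \<Longrightarrow> norm (g y - g x - D * (y - x)) \<le> e * norm (y - x)"
    using assms(1,3) unfolding has_field_derivative_def has_derivative_at_alt by blast
  show thesis
  proof (rule that[OF \<open>r > 0\<close>])
    fix u v assume uv: "u \<le> x" "x \<le> v" "{u..v} \<subseteq> ball x r"
    then have "u \<in> ball x r" "v \<in> ball x r" by (auto simp del: mem_ball)
    then have "\<bar>g u - g x - D * (u - x)\<bar> \<le> e * (x - u)" "\<bar>g v - g x - D * (v - x)\<bar> \<le> e * (v - x)"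
      using r[of u] r[of v] uv by (auto simp: dist_real_def abs_of_nonpos)
    then have "g v - g u \<le> (D + e) * (v - u)"
      by (simp add: algebra_simps abs_if split: if_splits)
    also have "\<dots> \<le> (m + e) * (v - u)"
      using assms(2) uv by (intro mult_right_mono) auto
    finally show "g v - g u \<le> (m + e) * (v - u)" .
  qed
qed

text \<open>A Henstock gauge argument: pieces tagged outside \<open>N\<close> are controlled by the derivative there,
  while pieces tagged in \<open>N\<close> lie in an open set of small measure and are controlled by absolute
  continuity.\<close>

lemma abs_continuous_increment_le:
  fixes g :: "real \<Rightarrow> real"
  assumes ac: "abs_continuous_on_interval a b g" and "a \<le> b"
    and N: "N \<in> null_sets lborel"
    and der: "\<And>x. x \<in> {a..b} - N \<Longrightarrow> (g has_real_derivative g' x) (at x)"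
    and le: "\<And>x. x \<in> {a..b} - N \<Longrightarrow> g' x \<le> m"
  shows "g b - g a \<le> m * (b - a)"
proof -
  \<comment> \<open>The error consists of \<open>e * (b - a)\<close> from the slope
    \<open>m + e\<close>, one \<open>e\<close> for the variation of \<open>g\<close> over the pieces
    tagged in \<open>N\<close>, and one \<open>e\<close> for \<open>\<bar>m + e\<bar>\<close> times
    their total length.\<close>
  have bound: "g b - g a \<le> m * (b - a) + e * (b - a + 2)" if "e > 0" for e
  proof -
    from ac \<open>e > 0\<close> obtain d where "d > 0" and
      d: "\<And>I. finite I \<Longrightarrow> \<forall>(u, v)\<in>I. a \<le> u \<and> u \<le> v \<and> v \<le> b \<Longrightarrow>
        disjoint_family_on (\<lambda>(u, v). {u<..<v}) I \<Longrightarrow> (\<Sum>(u, v)\<in>I. v - u) < d \<Longrightarrow>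
        (\<Sum>(u, v)\<in>I. \<bar>g v - g u\<bar>) < e"
      unfolding abs_continuous_on_interval_def by meson
    \<comment> \<open>The second bound ensures \<open>\<bar>m + e\<bar> * d' \<le> e\<close>; the
      summand 1 keeps its denominator positive.\<close>
    define d' where "d' = min d (e / (\<bar>m + e\<bar> + 1))"
    have "d' > 0" using \<open>d > 0\<close> \<open>e > 0\<close> by (simp add: d'_def add_nonneg_pos)
    have "\<bar>m + e\<bar> * d' \<le> (\<bar>m + e\<bar> + 1) * (e / (\<bar>m + e\<bar> + 1))"
      using \<open>d' > 0\<close> by (intro mult_mono) (auto simp: d'_def)
    then have d'_e: "\<bar>m + e\<bar> * d' \<le> e" by (simp add: add_nonneg_pos)
    have N': "N \<in> null_sets lebesgue" by (rule null_sets_completionI[OF N])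
    then obtain U where U: "open U" "N \<subseteq> U" "U - N \<in> lmeasurable"
        "emeasure lebesgue (U - N) < ennreal d'"
      using sets_lebesgue_outer_open[of N d'] \<open>d' > 0\<close> by blast
    have "emeasure lebesgue U < ennreal d'"
      using U(1,4) N' by (simp add: emeasure_Diff_null_set)
    moreover from this have "U \<in> lmeasurable"
      using U(1) by (intro fmeasurableI) (auto intro: order.strict_trans)
    ultimately have U': "U \<in> lmeasurable" "measure lebesgue U < d'"
      using \<open>d' > 0\<close> by (auto simp: emeasure_eq_measure2 ennreal_less_iff)
    have "\<exists>r>0. x \<in> {a..b} - N \<longrightarrow> (\<forall>u v. u \<le> x \<longrightarrow> x \<le> v \<longrightarrow> {u..v} \<subseteq> ball x r \<longrightarrow>
              g v - g u \<le> (m + e) * (v - u))" for x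
      using has_real_derivative_increment_le[OF der le \<open>e > 0\<close>, of x] zero_less_one by metis
    then obtain r where r: "\<And>x. r x > 0"
      "\<And>x u v. x \<in> {a..b} - N \<Longrightarrow> u \<le> x \<Longrightarrow> x \<le> v \<Longrightarrow> {u..v} \<subseteq> ball x (r x) \<Longrightarrow>
         g v - g u \<le> (m + e) * (v - u)"
      by metis
    \<comment> \<open>A gauge assigns to each point an open neighbourhood of any shape, so all
      points of \<open>N\<close> can share \<open>U\<close>.\<close>
    define G where "G x = (if x \<in> N then U else ball x (r x))" for x
    have "gauge G" using U r by (auto simp: gauge_def G_def)
    then obtain p where p: "p tagged_division_of {a..b}" "G fine p"
      by (rule fine_division_exists_real)
    note pD = tagged_division_ofD[OF p(1)]
    have K: "\<exists>u v. K = {u..v} \<and> u \<le> v \<and> u \<le> x \<and> x \<le> v \<and> a \<le> u \<and> v \<le> b \<and> Inf K = u \<and> Sup K = v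
                \<and> x \<in> {a..b}" if "(x, K) \<in> p" for x K
    proof -
      from pD(4)[OF that] obtain u v where uv: "K = {u..v}" by auto
      with pD(2,3)[OF that] have "u \<le> x" "x \<le> v" "{u..v} \<subseteq> {a..b}" "x \<in> {a..b}" by auto
      then show ?thesis using uv by auto
    qed
    define q where "q = {(x, K) \<in> p. x \<in> N}"
    have "q \<subseteq> p" by (auto simp: q_def)
    have "finite q" using \<open>q \<subseteq> p\<close> pD(1) finite_subset by blast
    have q_div: "snd ` q division_of \<Union>(snd ` q)"
      using p(1) \<open>q \<subseteq> p\<close> unfolding tagged_division_of_def
      by (metis partial_division_of_tagged_division tagged_partial_division_subset)
    have inter: "interior K \<inter> interior L = {}"
      if "(x, K) \<in> p" "(y, L) \<in> p" "(x, K) \<noteq> (y, L)" for x K y L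
      using pD(5)[OF that] by simp
    have ends_eq: "Sup K = Inf K"
      if "(x, K) \<in> q" "(y, L) \<in> q" "(x, K) \<noteq> (y, L)" "(Inf K, Sup K) = (Inf L, Sup L)" for x K y L
    proof -
      have xy: "(x, K) \<in> p" "(y, L) \<in> p" using that \<open>q \<subseteq> p\<close> by auto
      obtain u v where "K = {u..v}" "u \<le> v" "Inf K = u" "Sup K = v" using K[OF xy(1)] by blast
      moreover from this that(4) have "L = {u..v}" using K[OF xy(2)] by force
      ultimately show ?thesis using inter[OF xy that(3)] by (cases "u < v") auto
    qed
    define I where "I = (\<lambda>(x, K). (Inf K, Sup K)) ` q"
    have sum_I: "(\<Sum>(u, v)\<in>I. h u v) = (\<Sum>(x, K)\<in>q. h (Inf K) (Sup K))"
      if "\<And>u. h u u = 0" for h :: "real \<Rightarrow> real \<Rightarrow> real"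
      unfolding I_def
      by (subst sum.reindex_nontrivial[OF \<open>finite q\<close>])
         (auto simp: case_prod_unfold that dest: ends_eq intro!: sum.cong)
    \<comment> \<open>The pieces tagged in \<open>N\<close> do not overlap, so their total length is
      the measure of their union, which lies in \<open>U\<close> by fineness.\<close>
    have "(\<Sum>(x, K)\<in>q. Sup K - Inf K) = (\<Sum>K\<in>snd ` q. measure lebesgue K)"
    proof -
      have "(\<Sum>K\<in>snd ` q. measure lebesgue K) = (\<Sum>(x, K)\<in>q. measure lebesgue K)"
      proof (subst sum.reindex_nontrivial[OF \<open>finite q\<close>])
        fix s t assume st: "s \<in> q" "t \<in> q" "s \<noteq> t" "snd s = snd t"
        obtain u v where "snd s = {u..v}" "u \<le> v" "Inf (snd s) = u" "Sup (snd s) = v"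
          using K[of "fst s" "snd s"] st(1) \<open>q \<subseteq> p\<close> by (metis prod.collapse subsetD)
        with ends_eq[of "fst s" "snd s" "fst t" "snd t"] st
        show "measure lebesgue (snd s) = 0" by (cases s; cases t) auto
      qed (simp add: case_prod_unfold)
      also have "\<dots> = (\<Sum>(x, K)\<in>q. Sup K - Inf K)"
      proof (rule sum.cong[OF refl], clarify)
        fix x K assume "(x, K) \<in> q"
        then obtain u v where "K = {u..v}" "u \<le> v" using K[of x K] \<open>q \<subseteq> p\<close> by blast
        then show "measure lebesgue K = Sup K - Inf K" by simp
      qed
      finally show ?thesis by simp
    qed
    also have "\<dots> = measure lebesgue (\<Union>(snd ` q))"
      by (rule content_division[OF q_div])
    also have "\<dots> \<le> measure lebesgue U"
      using p(2) U'(1) lmeasurable_division[OF q_div]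
      by (intro measure_mono_fmeasurable) (fastforce simp: q_def fine_def G_def fmeasurableD)+
    finally have len: "(\<Sum>(x, K)\<in>q. Sup K - Inf K) < d'" using U'(2) by simp
    have var: "(\<Sum>(x, K)\<in>q. \<bar>g (Sup K) - g (Inf K)\<bar>) < e"
    proof -
      have "(\<Sum>(u, v)\<in>I. \<bar>g v - g u\<bar>) < e"
      proof (rule d)
        show "finite I" using \<open>finite q\<close> by (simp add: I_def)
        show "\<forall>(u, v)\<in>I. a \<le> u \<and> u \<le> v \<and> v \<le> b"
          using K \<open>q \<subseteq> p\<close> by (fastforce simp: I_def)
        show "(\<Sum>(u, v)\<in>I. v - u) < d" using len by (subst sum_I) (auto simp: d'_def)
        show "disjoint_family_on (\<lambda>(u, v). {u<..<v}) I"
          unfolding disjoint_family_on_def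
        proof (intro ballI impI)
          fix s t assume st: "s \<in> I" "t \<in> I" "s \<noteq> t"
          obtain x K where "(x, K) \<in> q" "s = (Inf K, Sup K)" using st(1) by (auto simp: I_def)
          moreover obtain y L where "(y, L) \<in> q" "t = (Inf L, Sup L)" using st(2) by (auto simp: I_def)
          ultimately have xy: "(x, K) \<in> p" "s = (Inf K, Sup K)" "(y, L) \<in> p" "t = (Inf L, Sup L)"
            using \<open>q \<subseteq> p\<close> by auto
          with st have "(x, K) \<noteq> (y, L)" by auto
          from inter[OF xy(1,3) this] show "(case s of (u, v) \<Rightarrow> {u<..<v}) \<inter> (case t of (u, v) \<Rightarrow> {u<..<v}) = {}"
            using K[OF xy(1)] K[OF xy(3)] xy(2,4) by (elim exE conjE) (simp add: interior_atLeastAtMost_real)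
        qed
      qed
      then show ?thesis by (subst (asm) sum_I) auto
    qed
    have "g b - g a = (\<Sum>(x, K)\<in>p. g (Sup K) - g (Inf K))"
      using additive_tagged_division_1[OF \<open>a \<le> b\<close> p(1), of g] by simp
    \<comment> \<open>The slope \<open>m + e\<close> is charged to every piece so that the lengths
      telescope to \<open>b - a\<close>. On pieces tagged in \<open>N\<close> the extra
      \<open>\<bar>m + e\<bar>\<close> term makes up for a possibly negative slope.\<close>
    also have "\<dots> \<le> (\<Sum>(x, K)\<in>p. (m + e) * (Sup K - Inf K) +
        (if x \<in> N then \<bar>g (Sup K) - g (Inf K)\<bar> + \<bar>m + e\<bar> * (Sup K - Inf K) else 0))"
    proof (rule sum_mono, clarify)
      fix x K assume xK: "(x, K) \<in> p"
      then obtain u v where uv: "K = {u..v}" "u \<le> v" "u \<le> x" "x \<le> v" "Inf K = u" "Sup K = v" "x \<in> {a..b}"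
        using K by blast
      show "g (Sup K) - g (Inf K) \<le> (m + e) * (Sup K - Inf K) +
        (if x \<in> N then \<bar>g (Sup K) - g (Inf K)\<bar> + \<bar>m + e\<bar> * (Sup K - Inf K) else 0)"
      proof (cases "x \<in> N")
        case True
        have "0 \<le> (m + e + \<bar>m + e\<bar>) * (v - u)" using uv by (intro mult_nonneg_nonneg) auto
        with True show ?thesis unfolding uv(5,6) by (simp add: algebra_simps)
      next
        case False
        then have "{u..v} \<subseteq> ball x (r x)" using p(2) xK uv(1) by (fastforce simp: fine_def G_def simp del: mem_ball)
        then show ?thesis using r(2)[of x u v] False uv(3,4,7) unfolding uv(5,6) by auto
      qed
    qed
    also have "\<dots> = (m + e) * (\<Sum>(x, K)\<in>p. Sup K - Inf K) +
        ((\<Sum>(x, K)\<in>q. \<bar>g (Sup K) - g (Inf K)\<bar>) + \<bar>m + e\<bar> * (\<Sum>(x, K)\<in>q. Sup K - Inf K))"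
      unfolding q_def
      by (simp add: case_prod_unfold sum_distrib_left sum.inter_filter[OF pD(1)] flip: sum.distrib)
         (rule sum.cong, auto)
    also have "(\<Sum>(x, K)\<in>p. Sup K - Inf K) = b - a"
      using additive_tagged_division_1[OF \<open>a \<le> b\<close> p(1), of "\<lambda>x. x"] by simp
    also have "\<bar>m + e\<bar> * (\<Sum>(x, K)\<in>q. Sup K - Inf K) \<le> \<bar>m + e\<bar> * d'"
      using len by (intro mult_left_mono) auto
    finally show ?thesis using var d'_e by (simp add: algebra_simps)
  qed
  show ?thesis
  proof (rule field_le_epsilon)
    fix e :: real assume "e > 0"
    then show "g b - g a \<le> m * (b - a) + e"
      using bound[of "e / (b - a + 2)"] \<open>a \<le> b\<close> by simp
  qed
qed

section \<open>Convexity of the loss and the conditional risk\<close>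

text \<open>Off \<open>N\<close>, the derivative is at least \<open>deriv W x\<close> to the right
  of \<open>x\<close> and at most \<open>deriv W x\<close> to its left. The increment bound, applied
  to \<open>- W\<close> on the right and to \<open>W\<close> on the left, puts the tangent at
  \<open>x\<close> below \<open>W\<close> everywhere, also over points of \<open>N\<close>.\<close>

lemma deriv_nondecreasing_ae_subgradient:
  assumes "deriv_nondecreasing_ae W"
  obtains N where "N \<in> null_sets lborel" "mono_on (- N) (deriv W)"
    "\<And>x y. x \<notin> N \<Longrightarrow> W x + deriv W x * (y - x) \<le> W y"
proof -
  obtain N where N: "N \<in> null_sets lborel" and diff: "\<And>t. t \<notin> N \<Longrightarrow> W differentiable (at t)"
    and mono: "mono_on (- N) (deriv W)" and ac: "\<And>a b. abs_continuous_on_interval a b W"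
    using assms unfolding deriv_nondecreasing_ae_def by auto
  have der: "(W has_real_derivative deriv W t) (at t)" if "t \<notin> N" for t
    using diff[OF that] DERIV_deriv_iff_real_differentiable by blast
  have "W x + deriv W x * (y - x) \<le> W y" if x: "x \<notin> N" for x y
  proof (cases "x \<le> y")
    case True
    have "- W y - - W x \<le> - deriv W x * (y - x)"
      using True N x
      by (intro abs_continuous_increment_le[where N = N and g' = "\<lambda>t. - deriv W t"]
           abs_continuous_on_interval_uminus ac DERIV_minus der) (auto intro: mono_onD[OF mono])
    then show ?thesis by simp
  next
    case False
    have "W x - W y \<le> deriv W x * (x - y)"
      using False N x
      by (intro abs_continuous_increment_le[where N = N and g' = "deriv W"] ac der)
         (auto intro: mono_onD[OF mono])
    then show ?thesis by (simp add: algebra_simps)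
  qed
  with N mono show thesis by (rule that)
qed


text \<open>The weight \<open>p\<close> will be the unnormalised section of \<open>f\<close> along a
  fixed value of D, so that the risk splits without dividing by the marginal density.\<close>

lemma conditional_risk_le:
  fixes W p :: "real \<Rightarrow> real"
  assumes W_nonneg: "\<And>t. 0 \<le> W t" and W_borel [measurable]: "W \<in> borel_measurable borel"
    and W: "deriv_nondecreasing_ae W"
    and p_nonneg: "\<And>s. 0 \<le> p s" and p_borel [measurable]: "p \<in> borel_measurable borel"
    and eq: "has_bochner_integral lborel (\<lambda>s. deriv W (s - c) * p s) 0"
    and between: "a \<le> b \<and> b \<le> c \<or> c \<le> b \<and> b \<le> a"
  shows "(\<integral>\<^sup>+s. ennreal (W (s - b) * p s) \<partial>lborel) \<le> (\<integral>\<^sup>+s. ennreal (W (s - a) * p s) \<partial>lborel)"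
proof (cases "(\<integral>\<^sup>+s. ennreal (W (s - a) * p s) \<partial>lborel) = \<infinity>")
  case False
  obtain N where N: "N \<in> null_sets lborel" and mono: "mono_on (- N) (deriv W)"
    and sub: "\<And>x y. x \<notin> N \<Longrightarrow> W x + deriv W x * (y - x) \<le> W y"
    using deriv_nondecreasing_ae_subgradient[OF W] by metis
  \<comment> \<open>Lebesgue null sets are translation invariant.\<close>
  have ae: "AE s in lborel. s - d \<notin> N" for d
  proof -
    have "AE s in lborel. s \<notin> N" using N by (rule AE_not_in)
    then have "AE s in distr lborel borel (\<lambda>s. - d + s). s \<notin> N"
      by (subst lborel_distr_plus)
    then show ?thesis using N by (subst (asm) AE_distr_iff) auto
  qed
  have pointwise: "AE s in lborel. W (s - b) * p s + (b - a) * (deriv W (s - c) * p s) \<le> W (s - a) * p s"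
    using ae[of b] ae[of c]
  proof eventually_elim
    fix s assume s: "s - b \<notin> N" "s - c \<notin> N"
    \<comment> \<open>The differences \<open>b - a\<close> and
      \<open>deriv W (s - b) - deriv W (s - c)\<close> are both nonnegative or both nonpositive, by
      the position of \<open>b\<close> between \<open>a\<close> and \<open>c\<close>.\<close>
    have "(b - a) * deriv W (s - c) \<le> (b - a) * deriv W (s - b)"
    proof (cases "a \<le> b \<and> b \<le> c")
      case True
      then show ?thesis using s by (intro mult_left_mono mono_onD[OF mono]) auto
    next
      case False
      with between have "c \<le> b" "b \<le> a" by auto
      then show ?thesis using s by (intro mult_left_mono_neg mono_onD[OF mono]) auto
    qed
    with sub[OF s(1), of "s - a"] have "W (s - b) + (b - a) * deriv W (s - c) \<le> W (s - a)"
      by (simp add: algebra_simps)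
    from mult_right_mono[OF this p_nonneg[of s]]
    show "W (s - b) * p s + (b - a) * (deriv W (s - c) * p s) \<le> W (s - a) * p s"
      by (simp add: algebra_simps)
  qed
  have a_int: "integrable lborel (\<lambda>s. W (s - a) * p s)"
    using False W_nonneg p_nonneg by (intro integrableI_nonneg) (auto simp: top.not_eq_extremum)
  have c_int: "integrable lborel (\<lambda>s. (b - a) * (deriv W (s - c) * p s))"
    "(\<integral>s. (b - a) * (deriv W (s - c) * p s) \<partial>lborel) = 0"
    using has_bochner_integral_mult_right[OF eq, of "b - a"]
    by (auto simp: has_bochner_integral_iff)
  \<comment> \<open>The pointwise inequality itself provides the integrable majorant, because its
    left summand \<open>W (s - b) * p s\<close> is nonnegative.\<close>
  have b_int: "integrable lborel (\<lambda>s. W (s - b) * p s)"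
  proof (rule Bochner_Integration.integrable_bound)
    show "integrable lborel (\<lambda>s. W (s - a) * p s - (b - a) * (deriv W (s - c) * p s))"
      using a_int c_int by simp
    show "AE s in lborel. norm (W (s - b) * p s) \<le>
        norm (W (s - a) * p s - (b - a) * (deriv W (s - c) * p s))"
      using pointwise
    proof eventually_elim
      case (elim s)
      moreover have "0 \<le> W (s - b) * p s" using W_nonneg p_nonneg by simp
      ultimately show ?case by (simp only: real_norm_def)
    qed
  qed auto
  have "(\<integral>s. W (s - b) * p s \<partial>lborel) =
      (\<integral>s. W (s - b) * p s + (b - a) * (deriv W (s - c) * p s) \<partial>lborel)"
    using b_int c_int by simp
  also have "\<dots> \<le> (\<integral>s. W (s - a) * p s \<partial>lborel)"
    using a_int b_int c_int pointwise by (intro integral_mono_AE) auto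
  finally show ?thesis
    using a_int b_int W_nonneg p_nonneg by (simp add: nn_integral_eq_integral)
qed simp

section \<open>Disintegration of the risk along D\<close>

text \<open>Change of variables \<open>t = x2 - x1\<close>, \<open>s = x2 - snd \<theta>\<close>,
  with Jacobian of absolute value 1. The order of integration is swapped in between, so that the
  inner integral runs over \<open>s\<close> at fixed D = \<open>t\<close>.\<close>

lemma nn_integral_location_model:
  assumes [measurable]: "f \<in> borel_measurable borel" "h \<in> borel_measurable borel"
  shows "(\<integral>\<^sup>+x. h x \<partial>location_model f \<theta>) =
    (\<integral>\<^sup>+t. \<integral>\<^sup>+s. h (s + snd \<theta> - t, s + snd \<theta>) * ennreal (f (s - (t - (snd \<theta> - fst \<theta>)), s)) \<partial>lborel \<partial>lborel)"
proof -
  define H where "H x1 x2 = ennreal (f (x1 - fst \<theta>, x2 - snd \<theta>)) * h (x1, x2)" for x1 x2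
  have [measurable]: "f \<in> borel_measurable (borel \<Otimes>\<^sub>M borel)" "h \<in> borel_measurable (borel \<Otimes>\<^sub>M borel)"
    by (simp_all add: borel_prod)
  have H [measurable]: "case_prod H \<in> borel_measurable (borel \<Otimes>\<^sub>M borel)"
    unfolding H_def by measurable
  have "(\<integral>\<^sup>+x. h x \<partial>location_model f \<theta>) = (\<integral>\<^sup>+x. case_prod H x \<partial>(lborel \<Otimes>\<^sub>M lborel))"
    unfolding location_model_def lborel_prod[symmetric]
    by (subst nn_integral_density) (auto simp: H_def case_prod_unfold)
  also have "\<dots> = (\<integral>\<^sup>+x2. \<integral>\<^sup>+x1. H x1 x2 \<partial>lborel \<partial>lborel)"
    by (subst lborel_pair.nn_integral_snd[symmetric]) auto
  also have "\<dots> = (\<integral>\<^sup>+x2. \<integral>\<^sup>+t. H (x2 - t) x2 \<partial>lborel \<partial>lborel)"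
  proof (rule nn_integral_cong)
    fix x2 :: real
    show "(\<integral>\<^sup>+x1. H x1 x2 \<partial>lborel) = (\<integral>\<^sup>+t. H (x2 - t) x2 \<partial>lborel)"
      by (subst nn_integral_real_affine[where c = "-1" and t = x2]) auto
  qed
  also have "\<dots> = (\<integral>\<^sup>+t. \<integral>\<^sup>+x2. H (x2 - t) x2 \<partial>lborel \<partial>lborel)"
    by (rule lborel_pair.Fubini') simp
  also have "\<dots> = (\<integral>\<^sup>+t. \<integral>\<^sup>+s. H (snd \<theta> + s - t) (snd \<theta> + s) \<partial>lborel \<partial>lborel)"
  proof (rule nn_integral_cong)
    fix t :: real
    show "(\<integral>\<^sup>+x2. H (x2 - t) x2 \<partial>lborel) = (\<integral>\<^sup>+s. H (snd \<theta> + s - t) (snd \<theta> + s) \<partial>lborel)"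
      by (subst nn_integral_real_affine[where c = 1 and t = "snd \<theta>"]) auto
  qed
  finally show ?thesis by (simp add: H_def algebra_simps)
qed

text \<open>Only the estimator on the larger side has to be measurable: the lower integral on the left
  is tested against simple minorants, to which Fubini applies.\<close>

lemma risk2_equivariant_mono:
  assumes f [measurable]: "f \<in> borel_measurable borel" and f_nonneg: "\<And>x. 0 \<le> f x"
    and W [measurable]: "W \<in> borel_measurable borel" and W_nonneg: "\<And>t. 0 \<le> W t"
    and \<psi> [measurable]: "\<psi> \<in> borel_measurable borel"
    and le: "\<And>t. (\<integral>\<^sup>+s. ennreal (W (s - \<phi> t) * f (s - (t - (snd \<theta> - fst \<theta>)), s)) \<partial>lborel)
               \<le> (\<integral>\<^sup>+s. ennreal (W (s - \<psi> t) * f (s - (t - (snd \<theta> - fst \<theta>)), s)) \<partial>lborel)"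
  shows "risk2 f W \<theta> (equivariant_est \<phi>) \<le> risk2 f W \<theta> (equivariant_est \<psi>)"
proof -
  have "integral\<^sup>S (location_model f \<theta>) g \<le> risk2 f W \<theta> (equivariant_est \<psi>)"
    if g: "simple_function (location_model f \<theta>) g"
      and g_le: "\<And>x. g x \<le> ennreal (W (equivariant_est \<phi> x - snd \<theta>))" for g
  proof -
    have [measurable]: "g \<in> borel_measurable borel"
      using borel_measurable_simple_function[OF g]
      by (simp add: location_model_def cong: measurable_cong_sets)
    have "integral\<^sup>S (location_model f \<theta>) g = (\<integral>\<^sup>+x. g x \<partial>location_model f \<theta>)"
      by (rule nn_integral_eq_simple_integral[OF g, symmetric])
    also have "\<dots> = (\<integral>\<^sup>+t. \<integral>\<^sup>+s. g (s + snd \<theta> - t, s + snd \<theta>) *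
        ennreal (f (s - (t - (snd \<theta> - fst \<theta>)), s)) \<partial>lborel \<partial>lborel)"
      by (rule nn_integral_location_model) simp_all
    \<comment> \<open>At fixed \<open>t\<close> the value \<open>\<phi> t\<close> is a constant. The
      outer integral over \<open>t\<close> may be a lower integral, for which monotonicity still
      holds.\<close>
    also have "\<dots> \<le> (\<integral>\<^sup>+t. \<integral>\<^sup>+s. ennreal (W (s - \<phi> t) * f (s - (t - (snd \<theta> - fst \<theta>)), s)) \<partial>lborel \<partial>lborel)"
    proof (intro nn_integral_mono)
      fix t s :: real
      show "g (s + snd \<theta> - t, s + snd \<theta>) * ennreal (f (s - (t - (snd \<theta> - fst \<theta>)), s))
          \<le> ennreal (W (s - \<phi> t) * f (s - (t - (snd \<theta> - fst \<theta>)), s))"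
        using g_le[of "(s + snd \<theta> - t, s + snd \<theta>)"] W_nonneg f_nonneg
        by (simp add: equivariant_est_def ennreal_mult mult_right_mono)
    qed
    also have "\<dots> \<le> (\<integral>\<^sup>+t. \<integral>\<^sup>+s. ennreal (W (s - \<psi> t) * f (s - (t - (snd \<theta> - fst \<theta>)), s)) \<partial>lborel \<partial>lborel)"
      by (intro nn_integral_mono le)
    also have "\<dots> = risk2 f W \<theta> (equivariant_est \<psi>)"
    proof -
      have "(\<lambda>x. ennreal (W (equivariant_est \<psi> x - snd \<theta>))) \<in> borel_measurable borel"
        unfolding equivariant_est_def borel_prod[symmetric] by measurable
      then show ?thesis
        unfolding risk2_def using W_nonneg f_nonneg
        by (subst nn_integral_location_model) (auto simp: equivariant_est_def ennreal_mult)
    qed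
    finally show ?thesis .
  qed
  then show ?thesis
    unfolding risk2_def[of f W \<theta> "equivariant_est \<phi>"] nn_integral_def
    by (intro SUP_least) (auto simp: le_fun_def)
qed

section \<open>Truncation and comparison of the risks\<close>

theorem theorem2p2p1:
  fixes f :: "real \<times> real \<Rightarrow> real"
    and W :: "real \<Rightarrow> real"
    and \<psi>sol :: "real \<Rightarrow> real \<Rightarrow> real"
    and \<psi> \<psi>lo \<psi>up \<psi>star :: "real \<Rightarrow> real"
  assumes density: "prob_density f"
    and W_nonneg: "\<forall>t. 0 \<le> W t"
    and C1: "W 0 = 0" "antimono_on {..<0} W" "mono_on {0<..} W"
    and C2: "deriv_nondecreasing_ae W"
    and A2: "\<forall>lam\<ge>0. \<forall>t.
               (\<forall>c. solves_equation f W (t - lam) c \<longleftrightarrow> c = \<psi>sol lam t) \<and>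
               cond_density f (t - lam) (\<psi>sol lam t) > 0"
    and psi_measurable: "\<psi> \<in> borel_measurable borel"
    and bounds: "\<forall>lam\<ge>0. \<forall>t. \<psi>lo t < \<psi>sol lam t \<and> \<psi>sol lam t < \<psi>up t"
    and psi_star: "\<forall>t. \<psi>star t = min (max (\<psi>lo t) (\<psi> t)) (\<psi>up t)"
  shows "(\<forall>t. \<psi>star t = max (\<psi>lo t) (min (\<psi> t) (\<psi>up t))) \<and>
         (\<forall>\<theta>\<in>Theta0. risk2 f W \<theta> (equivariant_est \<psi>) \<ge> risk2 f W \<theta> (equivariant_est \<psi>star))"
proof (intro conjI allI ballI)
  fix t
  \<comment> \<open>The two orders of truncation agree once the bounds are ordered, which follows
    from the instance \<open>lam = 0\<close>.\<close>
  have "\<psi>lo t < \<psi>up t" using bounds by (meson order.strict_trans order_refl)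
  then show "\<psi>star t = max (\<psi>lo t) (min (\<psi> t) (\<psi>up t))" using psi_star by auto
next
  fix \<theta> :: "real \<times> real"
  assume "\<theta> \<in> Theta0"
  define lam where "lam = snd \<theta> - fst \<theta>"
  have "lam \<ge> 0" using \<open>\<theta> \<in> Theta0\<close> by (auto simp: Theta0_def lam_def)
  have f [measurable]: "f \<in> borel_measurable borel" and f_nonneg: "\<And>x. 0 \<le> f x"
    using density by (auto simp: prob_density_def)
  have [measurable]: "f \<in> borel_measurable (borel \<Otimes>\<^sub>M borel)" by (simp add: borel_prod)
  have W [measurable]: "W \<in> borel_measurable borel"
    using C2 unfolding deriv_nondecreasing_ae_def
    by (intro borel_measurable_continuous_onI abs_continuous_imp_continuous_on) auto
  have "(\<integral>\<^sup>+s. ennreal (W (s - \<psi>star t) * f (s - (t - lam), s)) \<partial>lborel)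
      \<le> (\<integral>\<^sup>+s. ennreal (W (s - \<psi> t) * f (s - (t - lam), s)) \<partial>lborel)" for t
  proof (rule conditional_risk_le[OF _ W C2])
    define D where "D = (\<integral>u. f (u - (t - lam), u) \<partial>lborel)"
    from A2 \<open>lam \<ge> 0\<close> have sol: "solves_equation f W (t - lam) (\<psi>sol lam t)"
      and pos: "cond_density f (t - lam) (\<psi>sol lam t) > 0" by auto
    \<comment> \<open>A zero denominator, be it a true zero or the default value of a divergent
      integral, would make the conditional density vanish. Multiplying the equation by
      \<open>D\<close> then removes the normalisation.\<close>
    from pos have "D \<noteq> 0" by (auto simp: cond_density_def D_def)
    then have "deriv W (s - c) * cond_density f (t - lam) s * D = deriv W (s - c) * f (s - (t - lam), s)" for s c
      by (simp add: cond_density_def flip: D_def)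
    then show "has_bochner_integral lborel (\<lambda>s. deriv W (s - \<psi>sol lam t) * f (s - (t - lam), s)) 0"
      using has_bochner_integral_mult_left[OF sol[unfolded solves_equation_def], of D]
      by (simp only: mult_zero_left)
    \<comment> \<open>Truncation to an interval that contains \<open>\<psi>sol lam t\<close> moves
      \<open>\<psi> t\<close> towards this point and never past it.\<close>
    have "\<psi>lo t < \<psi>sol lam t" "\<psi>sol lam t < \<psi>up t" using bounds \<open>lam \<ge> 0\<close> by auto
    then show "\<psi> t \<le> \<psi>star t \<and> \<psi>star t \<le> \<psi>sol lam t \<or> \<psi>sol lam t \<le> \<psi>star t \<and> \<psi>star t \<le> \<psi> t"
      using psi_star by (auto simp: min_def max_def)
  qed (use W_nonneg f_nonneg in auto)
  then show "risk2 f W \<theta> (equivariant_est \<psi>) \<ge> risk2 f W \<theta> (equivariant_est \<psi>star)"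
    using W_nonneg f_nonneg unfolding lam_def
    by (intro risk2_equivariant_mono[OF f _ W _ psi_measurable]) auto
qed

end
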